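(* Let $T=(V,E)$ be a contribution tree with root $d$, edge weights $w$ and importance scores $\sigma$. Then the following three properties hold. (i) Hierarchical conservation: for every internal node $u\in V$, $\sigma(u)=\sum_{v\in \mathrm{ch}(u)}\sigma(v)$. (ii) Efficiency: the total contribution is fully distributed across the leaves, i.e. $\sum_{\ell\in \mathrm{leaves}(T)}\sigma(\ell)=\sigma(d)=1$. (iii) Additivity: for every finite collection $\{S_i\}_{i=1}^m$ of pairwise disjoint subsets of $V$, $\sigma\left(\bigcup_{i=1}^m S_i\right)=\sum_{i=1}^m\sigma(S_i)$.
   Context: A contribution tree is a finite rooted tree $T=(V,E)$ with root $d$ and edges directed from parent to child. For a node $u$, $\mathrm{ch}(u)$ is its set of children; for a non-root node $v$, $\mathrm{par}(v)$ is its parent. Internal nodes are those with at least one child; leaves are those with no children. Each edge $(u,v)\in E$ carries a weight $w(u,v)\in[0,1]$, and for every internal node $u$ one has $\sum_{v\in\mathrm{ch}(u)}w(u,v)=1$. The importance score $\sigma:V\to[0,\infty)$ is defined by $\sigma(d)=1$ and, for every non-root node $v$, $\sigma(v)=w(\mathrm{par}(v),v)\cdot\sigma(\mathrm{par}(v))$ (equivalently, $\sigma(v)$ is the product of the edge weights along the path from the root to $v$). For a set of nodes $S\subseteq V$, its aggregate contribution is $\sigma(S)=\sum_{u\in S}\sigma(u)$. *)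

theory Defs
  imports "Graph_Theory.Pair_Digraph" "HOL-Library.Disjoint_Sets"
begin

text \<open>
  A finite rooted tree with edges directed away from the root: every node is the end of exactly
  one directed walk starting at the root. Uniqueness is required of walks, not only of paths
  without repeated nodes, since otherwise edges back to ancestors would not be excluded.
\<close>

locale rooted_tree = pair_fin_digraph T
  for T :: "'a pair_pre_digraph" +
  fixes d :: 'a
  assumes root_in_verts: "d \<in> pverts T"
    and unique_awalk: "\<And>v. v \<in> pverts T \<Longrightarrow> \<exists>!p. awalk d p v"

definition children :: "'a pair_pre_digraph \<Rightarrow> 'a \<Rightarrow> 'a set" where
  "children T u = {v. (u, v) \<in> parcs T}"

definition parent :: "'a pair_pre_digraph \<Rightarrow> 'a \<Rightarrow> 'a" where
  "parent T v = (THE u. (u, v) \<in> parcs T)"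

definition internal_nodes :: "'a pair_pre_digraph \<Rightarrow> 'a set" where
  "internal_nodes T = {u \<in> pverts T. children T u \<noteq> {}}"

definition leaves :: "'a pair_pre_digraph \<Rightarrow> 'a set" where
  "leaves T = {u \<in> pverts T. children T u = {}}"

locale contribution_tree = rooted_tree T d
  for T :: "'a pair_pre_digraph" and d :: 'a +
  fixes w :: "'a \<times> 'a \<Rightarrow> real"
  assumes weight_range: "\<And>e. e \<in> parcs T \<Longrightarrow> 0 \<le> w e \<and> w e \<le> 1"
    and weight_sum: "\<And>u. u \<in> internal_nodes T \<Longrightarrow> (\<Sum>v\<in>children T u. w (u, v)) = 1"

context rooted_tree
begin

definition depth :: "'a \<Rightarrow> nat" where
  "depth v = length (THE p. awalk d p v)"

lemma depth_awalk:
  assumes "awalk d p v"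
  shows "depth v = length p"
proof -
  have "v \<in> pverts T" using assms by auto
  then have "(THE q. awalk d q v) = p"
    using unique_awalk assms by (blast intro: the1_equality)
  then show ?thesis by (simp add: depth_def)
qed

lemma awalk_snoc:
  assumes "awalk d p u" "(u, v) \<in> parcs T"
  shows "awalk d (p @ [(u, v)]) v"
proof -
  have "awalk u [(u, v)] v"
    using assms(2) by (auto simp: awalk_def dest: in_arcsD1)
  with assms(1) show ?thesis by (rule awalk_appendI)
qed

lemma parent_eq:
  assumes e: "(u, v) \<in> parcs T"
  shows "parent T v = u"
  unfolding parent_def
proof (rule the_equality)
  show "(u, v) \<in> parcs T" by (rule e)
next
  fix u' assume e': "(u', v) \<in> parcs T"
  obtain p where p: "awalk d p u" using unique_awalk in_arcsD1[OF e] by blast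
  obtain p' where p': "awalk d p' u'" using unique_awalk in_arcsD1[OF e'] by blast
  have "p @ [(u, v)] = p' @ [(u', v)]"
    using unique_awalk[OF in_arcsD2[OF e]] awalk_snoc[OF p e] awalk_snoc[OF p' e'] by blast
  then show "u' = u" by simp
qed

lemma parent_arc:
  assumes "v \<in> pverts T" "v \<noteq> d"
  shows "(parent T v, v) \<in> parcs T"
proof -
  obtain p where p: "awalk d p v" using unique_awalk assms(1) by blast
  with assms(2) have "p \<noteq> []" by (auto simp: awalk_def)
  then obtain q a b where pq: "p = q @ [(a, b)]" by (metis rev_exhaust surj_pair)
  with p have "(a, v) \<in> parcs T" by (auto simp: awalk_def)
  then show ?thesis using parent_eq by simp
qed

lemma depth_arc:
  assumes e: "(u, v) \<in> parcs T"
  shows "depth v = Suc (depth u)"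
proof -
  obtain p where p: "awalk d p u" using unique_awalk in_arcsD1[OF e] by blast
  show ?thesis using depth_awalk[OF p] depth_awalk[OF awalk_snoc[OF p e]] by simp
qed

end

context contribution_tree
begin

text \<open>The value 0 outside the node set is arbitrary.\<close>

function importance :: "'a \<Rightarrow> real" where
  "importance v =
    (if v = d then 1
     else if v \<in> pverts T then w (parent T v, v) * importance (parent T v)
     else 0)"
  by auto
termination
proof (relation "measure depth")
  fix v assume "v \<noteq> d" "v \<in> pverts T"
  then show "(parent T v, v) \<in> measure depth"
    using depth_arc[OF parent_arc] by simp
qed simp

declare importance.simps [simp del]

definition contribution :: "'a set \<Rightarrow> real" where
  "contribution S = (\<Sum>u\<in>S. importance u)"

lemma importance_root: "importance d = 1"
  by (simp add: importance.simps)

lemma importance_nonroot: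
  "v \<in> pverts T \<Longrightarrow> v \<noteq> d \<Longrightarrow> importance v = w (parent T v, v) * importance (parent T v)"
  by (subst importance.simps) simp

lemma importance_nonneg: "0 \<le> importance v"
proof (induction v rule: importance.induct)
  case (1 v)
  then show ?case
    by (subst importance.simps) (auto intro!: mult_nonneg_nonneg dest: parent_arc weight_range)
qed

end

end

theory Submission
  imports Defs
begin

text \<open>
  Every node except the root is a child of exactly one internal node. Summing the conservation
  law over all internal nodes therefore shows that the internal nodes together contribute as much
  as all nodes except the root; comparing both with the total over all nodes, the leaves
  contribute as much as the root.
\<close>

context rooted_tree
begin

text \<open>The empty walk is the only walk from \<open>d\<close> to itself, so \<open>d\<close> has
  depth 0, whereas the head of an arc has a successor as its depth.\<close>

lemma no_arc_into_root: "(u, d) \<notin> parcs T"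
proof
  assume "(u, d) \<in> parcs T"
  moreover have "depth d = 0"
    using depth_awalk[of "[]" d] root_in_verts by (simp add: awalk_Nil_iff)
  ultimately show False using depth_arc by fastforce
qed

lemma children_subset: "children T u \<subseteq> pverts T - {d}"
  using no_arc_into_root by (auto simp: children_def dest: in_arcsD2)

lemma finite_children: "finite (children T u)"
  using children_subset finite_verts by (rule finite_subset[OF _ finite_Diff])

lemma disjoint_children: "u \<noteq> u' \<Longrightarrow> children T u \<inter> children T u' = {}"
  using parent_eq by (auto simp: children_def)

text \<open>The arc from \<open>parent T v\<close> to \<open>v\<close> itself witnesses that the
  parent is internal. Together with \<open>disjoint_children\<close> this partitions the non-root
  nodes by parent.\<close>

lemma UN_children: "(\<Union>u\<in>internal_nodes T. children T u) = pverts T - {d}"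
proof
  show "(\<Union>u\<in>internal_nodes T. children T u) \<subseteq> pverts T - {d}"
    using children_subset by blast
  show "pverts T - {d} \<subseteq> (\<Union>u\<in>internal_nodes T. children T u)"
  proof
    fix v assume "v \<in> pverts T - {d}"
    then have "(parent T v, v) \<in> parcs T" by (simp add: parent_arc)
    then show "v \<in> (\<Union>u\<in>internal_nodes T. children T u)"
      by (auto simp: internal_nodes_def children_def dest: in_arcsD1)
  qed
qed

end

context contribution_tree
begin

text \<open>Reads the recursion from the parent's side, so that \<open>importance u\<close> is a
  common factor in sums over the children of a fixed \<open>u\<close>.\<close>

lemma importance_child:
  assumes "v \<in> children T u"
  shows "importance v = w (u, v) * importance u"
proof -
  have "(u, v) \<in> parcs T" using assms by (simp add: children_def)
  moreover have "v \<in> pverts T" "v \<noteq> d" using assms children_subset by auto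
  ultimately show ?thesis using importance_nonroot parent_eq by simp
qed

text \<open>Once the common factor \<open>importance u\<close> is pulled out, the outgoing weights
  remain, and they sum to 1.\<close>

lemma importance_conservation:
  assumes "u \<in> internal_nodes T"
  shows "importance u = (\<Sum>v\<in>children T u. importance v)"
proof -
  have "(\<Sum>v\<in>children T u. importance v) = (\<Sum>v\<in>children T u. w (u, v)) * importance u"
    by (simp add: importance_child sum_distrib_right)
  then show ?thesis using weight_sum[OF assms] by simp
qed

lemma sum_importance_leaves: "(\<Sum>l\<in>leaves T. importance l) = importance d"
proof -
  have fin: "finite (internal_nodes T)" "finite (leaves T)"
    using finite_verts by (auto simp: internal_nodes_def leaves_def)
  have "(\<Sum>u\<in>internal_nodes T. importance u)
      = (\<Sum>u\<in>internal_nodes T. \<Sum>v\<in>children T u. importance v)"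
    by (simp add: importance_conservation)
  \<comment> \<open>Uniqueness of parents ensures that no node is counted twice.\<close>
  also have "\<dots> = (\<Sum>v\<in>(\<Union>u\<in>internal_nodes T. children T u). importance v)"
    using fin(1) finite_children disjoint_children by (subst sum.UNION_disjoint) auto
  also have "\<dots> = (\<Sum>v\<in>pverts T. importance v) - importance d"
    using finite_verts root_in_verts by (simp add: UN_children sum_diff1)
  finally have "(\<Sum>u\<in>internal_nodes T. importance u)
      = (\<Sum>v\<in>pverts T. importance v) - importance d" .
  \<comment> \<open>Splitting the total over all nodes makes the internal sum cancel, which leaves
    the leaves against the root.\<close>
  moreover have "pverts T = internal_nodes T \<union> leaves T" "internal_nodes T \<inter> leaves T = {}"
    by (auto simp: internal_nodes_def leaves_def)
  then have "(\<Sum>v\<in>pverts T. importance v)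
      = (\<Sum>u\<in>internal_nodes T. importance u) + (\<Sum>l\<in>leaves T. importance l)"
    using fin by (simp add: sum.union_disjoint)
  ultimately show ?thesis by simp
qed

lemma contribution_UN_disjoint:
  assumes "finite I" "\<And>i. i \<in> I \<Longrightarrow> S i \<subseteq> pverts T" "disjoint_family_on S I"
  shows "contribution (\<Union>i\<in>I. S i) = (\<Sum>i\<in>I. contribution (S i))"
  unfolding contribution_def
proof (rule sum.UNION_disjoint[OF assms(1)])
  \<comment> \<open>Finiteness matters because a sum over an infinite set is 0 by convention; here
    it is inherited from the node set.\<close>
  show "\<forall>i\<in>I. finite (S i)"
    using assms(2) finite_verts by (blast intro: finite_subset)
  show "\<forall>i\<in>I. \<forall>j\<in>I. i \<noteq> j \<longrightarrow> S i \<inter> S j = {}"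
    using assms(3) by (auto simp: disjoint_family_on_def)
qed

end

theorem theorem1:
  fixes T :: "'a pair_pre_digraph" and d :: 'a and w :: "'a \<times> 'a \<Rightarrow> real"
  assumes "contribution_tree T d w"
  shows
    "(\<forall>u\<in>internal_nodes T.
        contribution_tree.importance T d w u =
          (\<Sum>v\<in>children T u. contribution_tree.importance T d w v)) \<and>
     ((\<Sum>l\<in>leaves T. contribution_tree.importance T d w l) = contribution_tree.importance T d w d \<and>
      contribution_tree.importance T d w d = 1) \<and>
     (\<forall>(m :: nat) (S :: nat \<Rightarrow> 'a set).
        (\<forall>i\<in>{1..m}. S i \<subseteq> pverts T) \<and> disjoint_family_on S {1..m} \<longrightarrow>
        contribution_tree.contribution T d w (\<Union>i\<in>{1..m}. S i) =
          (\<Sum>i=1..m. contribution_tree.contribution T d w (S i)))"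
proof -
  interpret contribution_tree T d w by fact
  show ?thesis
    \<comment> \<open>Additivity is the instance \<open>I = {1..m}\<close>; for \<open>m = 0\<close>
      the family is empty and both sides are 0.\<close>
    by (intro conjI ballI allI impI importance_conservation sum_importance_leaves importance_root
        contribution_UN_disjoint) auto
qed

end
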